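(* Let $\pi$ be a unitary representation of a discrete group $\Gamma$, and let $\Lambda\le\Gamma$ be a subgroup. Then there is a $\Lambda$-embedding $\mathcal{B}_{\pi|_\Lambda}\hookrightarrow\mathcal{B}_\pi$, where $\mathcal{B}_{\pi|_\Lambda}$ is the Furstenberg--Hamana boundary of the restriction $\pi|_\Lambda$ as a representation of $\Lambda$, and $\mathcal{B}_\pi$ carries the $\Lambda$-action restricted from its $\Gamma$-action.
   Context: For a unitary representation $\pi:\Gamma\to\mathcal{U}(\mathcal{H}_\pi)$ of a discrete group $\Gamma$, $\Gamma$ acts on $B(\mathcal{H}_\pi)$ by $g\cdot x=\pi(g)x\pi(g^{-1})$. For any discrete group $\Gamma$, a $\Gamma$-map between operator systems carrying $\Gamma$-actions is a unital completely positive $\Gamma$-equivariant linear map; a $\Gamma$-embedding is a completely isometric $\Gamma$-map. Furstenberg--Hamana (FH) boundary: on the set $\mathcal{G}$ of all $\Gamma$-maps $\phi:B(\mathcal{H}_\pi)\to B(\mathcal{H}_\pi)$ put the preorder $\phi\le\psi$ iff $\|\phi(x)\|\le\|\psi(x)\|$ for all $x$. Then $\mathcal{G}$ has minimal elements, every minimal element is idempotent, and its image is unique up to bijective completely isometric $\Gamma$-maps. $\mathcal{B}_\pi$ is the image of a minimal $\phi\in\mathcal{G}$, with the Choi--Effros product $a\cdot b=\phi(ab)$ and the restricted $\Gamma$-action; it is a $\Gamma$-$C^*$-algebra. *)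

theory Defs
  imports "HOL-Analysis.Analysis" "HOL-Algebra.Group"
begin

section \<open>Complex Hilbert spaces\<close>

class scaleC = scaleR +
  fixes scaleC :: "complex \<Rightarrow> 'a \<Rightarrow> 'a" (infixr "*\<^sub>C" 75)

class complex_normed_vector = real_normed_vector + scaleC +
  assumes scaleC_add_right: "c *\<^sub>C (x + y) = c *\<^sub>C x + c *\<^sub>C y"
    and scaleC_add_left: "(c + d) *\<^sub>C x = c *\<^sub>C x + d *\<^sub>C x"
    and scaleC_scaleC: "c *\<^sub>C d *\<^sub>C x = (c * d) *\<^sub>C x"
    and scaleR_scaleC: "r *\<^sub>R x = complex_of_real r *\<^sub>C x"
    and norm_scaleC: "norm (c *\<^sub>C x) = cmod c * norm x"

text \<open>The inner product is antilinear in its first argument.\<close>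

class complex_hilbert = complex_normed_vector + complete_space +
  fixes cinner :: "'a \<Rightarrow> 'a \<Rightarrow> complex"
  assumes cinner_commute: "cinner x y = cnj (cinner y x)"
    and cinner_add_right: "cinner x (y + z) = cinner x y + cinner x z"
    and cinner_scaleC_right: "cinner x (c *\<^sub>C y) = c * cinner x y"
    and cinner_self: "cinner x x = complex_of_real ((norm x)\<^sup>2)"

lemma bounded_linear_scaleC: "bounded_linear (\<lambda>x::'a::complex_normed_vector. c *\<^sub>C x)"
  by (rule bounded_linear_intro[where K = "cmod c"])
     (simp_all add: scaleC_add_right scaleR_scaleC scaleC_scaleC norm_scaleC mult.commute)

lemmas scaleC_zero_right = linear_0[OF bounded_linear.linear[OF bounded_linear_scaleC]]
  and scaleC_minus_right = linear_neg[OF bounded_linear.linear[OF bounded_linear_scaleC]]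
  and scaleC_diff_right = linear_diff[OF bounded_linear.linear[OF bounded_linear_scaleC]]

section \<open>Bounded operators\<close>

typedef (overloaded) ('a::complex_normed_vector) bounded_op =
  "{T :: 'a \<Rightarrow>\<^sub>L 'a. \<forall>c x. blinfun_apply T (c *\<^sub>C x) = c *\<^sub>C blinfun_apply T x}"
  by (rule exI[of _ 0]) (simp add: scaleC_zero_right)

setup_lifting type_definition_bounded_op

lift_definition op_apply :: "'a::complex_normed_vector bounded_op \<Rightarrow> 'a \<Rightarrow> 'a"  (infixl "\<cdot>\<^sub>o" 90)
  is blinfun_apply .

text \<open>Sums, real multiples and the operator norm are those of real-bounded operators.\<close>

instantiation bounded_op :: (complex_normed_vector) complex_normed_vector
begin

lift_definition zero_bounded_op :: "'a bounded_op" is 0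
  by (simp add: scaleC_zero_right)

lift_definition plus_bounded_op :: "'a bounded_op \<Rightarrow> 'a bounded_op \<Rightarrow> 'a bounded_op" is "(+)"
  by (simp add: blinfun.bilinear_simps scaleC_add_right)

lift_definition uminus_bounded_op :: "'a bounded_op \<Rightarrow> 'a bounded_op" is "uminus"
  by (simp add: blinfun.bilinear_simps scaleC_minus_right)

lift_definition minus_bounded_op :: "'a bounded_op \<Rightarrow> 'a bounded_op \<Rightarrow> 'a bounded_op" is "(-)"
  by (simp add: blinfun.bilinear_simps scaleC_diff_right)

lift_definition scaleR_bounded_op :: "real \<Rightarrow> 'a bounded_op \<Rightarrow> 'a bounded_op" is "scaleR"
  by (simp add: blinfun.bilinear_simps scaleR_scaleC scaleC_scaleC mult.commute)

lift_definition scaleC_bounded_op :: "complex \<Rightarrow> 'a bounded_op \<Rightarrow> 'a bounded_op"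
  is "\<lambda>c T. Blinfun (\<lambda>x. c *\<^sub>C x) o\<^sub>L T"
  by (simp add: bounded_linear_Blinfun_apply bounded_linear_scaleC scaleC_scaleC mult.commute)

lift_definition norm_bounded_op :: "'a bounded_op \<Rightarrow> real" is norm .

lift_definition dist_bounded_op :: "'a bounded_op \<Rightarrow> 'a bounded_op \<Rightarrow> real" is dist .

lift_definition sgn_bounded_op :: "'a bounded_op \<Rightarrow> 'a bounded_op" is sgn
  by (simp add: sgn_div_norm blinfun.bilinear_simps scaleR_scaleC scaleC_scaleC mult.commute)

definition uniformity_bounded_op :: "('a bounded_op \<times> 'a bounded_op) filter"
  where "uniformity_bounded_op = (INF e\<in>{0<..}. principal {(S, T). dist S T < e})"

definition open_bounded_op :: "'a bounded_op set \<Rightarrow> bool"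
  where "open_bounded_op U \<longleftrightarrow>
    (\<forall>S\<in>U. \<forall>\<^sub>F (S', T) in uniformity. S' = S \<longrightarrow> T \<in> U)"

instance
proof
  fix S T U :: "'a bounded_op" and A :: "'a bounded_op set" and a b :: real and c d :: complex
  show "S + T + U = S + (T + U)" by transfer simp
  show "S + T = T + S" by transfer simp
  show "0 + S = S" by transfer simp
  show "- S + S = 0" by transfer simp
  show "S - T = S + - T" by transfer simp
  show "a *\<^sub>R (S + T) = a *\<^sub>R S + a *\<^sub>R T" by transfer (simp add: scaleR_add_right)
  show "(a + b) *\<^sub>R S = a *\<^sub>R S + b *\<^sub>R S" by transfer (simp add: scaleR_add_left)
  show "a *\<^sub>R b *\<^sub>R S = (a * b) *\<^sub>R S" by transfer simp
  show "1 *\<^sub>R S = S" by transfer simp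
  show "dist S T = norm (S - T)" by transfer (simp add: dist_norm)
  show "sgn S = inverse (norm S) *\<^sub>R S" by transfer (simp add: sgn_div_norm)
  show "uniformity = (INF e\<in>{0<..}. principal {(S, T :: 'a bounded_op). dist S T < e})"
    by (rule uniformity_bounded_op_def)
  show "open A \<longleftrightarrow> (\<forall>S\<in>A. \<forall>\<^sub>F (S', T) in uniformity. S' = S \<longrightarrow> T \<in> A)"
    by (rule open_bounded_op_def)
  show "norm S = 0 \<longleftrightarrow> S = 0" by transfer simp
  show "norm (S + T) \<le> norm S + norm T" by transfer (rule norm_triangle_ineq)
  show "norm (a *\<^sub>R S) = \<bar>a\<bar> * norm S" by transfer simp
  show "c *\<^sub>C (S + T) = c *\<^sub>C S + c *\<^sub>C T"
    by transfer (rule blinfun_eqI, simp add: bounded_linear_Blinfun_apply bounded_linear_scaleC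
      blinfun.bilinear_simps scaleC_add_right)
  show "(c + d) *\<^sub>C S = c *\<^sub>C S + d *\<^sub>C S"
    by transfer (rule blinfun_eqI, simp add: bounded_linear_Blinfun_apply bounded_linear_scaleC
      blinfun.bilinear_simps scaleC_add_left)
  show "c *\<^sub>C d *\<^sub>C S = (c * d) *\<^sub>C S"
    by transfer (rule blinfun_eqI, simp add: bounded_linear_Blinfun_apply bounded_linear_scaleC
      scaleC_scaleC)
  show "a *\<^sub>R S = complex_of_real a *\<^sub>C S"
    by transfer (rule blinfun_eqI, simp add: bounded_linear_Blinfun_apply bounded_linear_scaleC
      blinfun.bilinear_simps scaleR_scaleC)
  show "norm (c *\<^sub>C S) = cmod c * norm S"
  proof transfer
    fix c :: complex and S :: "'a \<Rightarrow>\<^sub>L 'a"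
    have *: "norm (Blinfun (\<lambda>x. c *\<^sub>C x) o\<^sub>L T) \<le> cmod c * norm T" for c and T :: "'a \<Rightarrow>\<^sub>L 'a"
      by (rule norm_blinfun_bound)
         (auto simp: bounded_linear_Blinfun_apply bounded_linear_scaleC norm_scaleC mult.assoc
           intro!: mult_left_mono norm_blinfun)
    show "norm (Blinfun (\<lambda>x. c *\<^sub>C x) o\<^sub>L S) = cmod c * norm S"
    proof (cases "c = 0")
      case True
      then show ?thesis using *[of 0 S] by simp
    next
      case False
      have "Blinfun (\<lambda>x. inverse c *\<^sub>C x) o\<^sub>L (Blinfun (\<lambda>x. c *\<^sub>C x) o\<^sub>L S) = S"
        by (rule blinfun_eqI)
           (simp add: bounded_linear_Blinfun_apply bounded_linear_scaleC scaleC_scaleC False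
             scaleR_scaleC[of 1, simplified, symmetric])
      then have "norm S \<le> inverse (cmod c) * norm (Blinfun (\<lambda>x. c *\<^sub>C x) o\<^sub>L S)"
        using *[of "inverse c" "Blinfun (\<lambda>x. c *\<^sub>C x) o\<^sub>L S"] by (simp add: norm_inverse)
      then have "cmod c * norm S \<le> norm (Blinfun (\<lambda>x. c *\<^sub>C x) o\<^sub>L S)"
        using False by (simp add: field_simps)
      with *[of c S] show ?thesis by linarith
    qed
  qed
qed

end

text \<open>The product of operators is composition.\<close>

instantiation bounded_op :: (complex_normed_vector) monoid_mult
begin

lift_definition one_bounded_op :: "'a bounded_op" is id_blinfun
  by simp

lift_definition times_bounded_op :: "'a bounded_op \<Rightarrow> 'a bounded_op \<Rightarrow> 'a bounded_op"
  is blinfun_compose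
  by simp

instance
  by standard (transfer, auto intro: blinfun_eqI)+

end

instance bounded_op :: (complex_normed_vector) real_normed_algebra
proof
  fix S T U :: "'a bounded_op" and a :: real
  show "(S + T) * U = S * U + T * U"
    by transfer (auto intro: blinfun_eqI simp: blinfun.bilinear_simps)
  show "S * (T + U) = S * T + S * U"
    by transfer (auto intro: blinfun_eqI simp: blinfun.bilinear_simps)
  show "a *\<^sub>R S * T = a *\<^sub>R (S * T)"
    by transfer (auto intro: blinfun_eqI simp: blinfun.bilinear_simps)
  show "S * a *\<^sub>R T = a *\<^sub>R (S * T)"
    by transfer (auto intro: blinfun_eqI simp: blinfun.bilinear_simps)
  show "norm (S * T) \<le> norm S * norm T"
    by transfer (rule norm_blinfun_compose)
qed

section \<open>Operator systems and completely positive maps\<close>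

definition is_adjoint :: "'h::complex_hilbert bounded_op \<Rightarrow> 'h bounded_op \<Rightarrow> bool"
  where "is_adjoint x y \<longleftrightarrow> (\<forall>\<xi> \<eta>. cinner (x \<cdot>\<^sub>o \<xi>) \<eta> = cinner \<xi> (y \<cdot>\<^sub>o \<eta>))"

definition operator_system :: "'h::complex_hilbert bounded_op set \<Rightarrow> bool"
  where "operator_system S \<longleftrightarrow>
    1 \<in> S \<and>
    (\<forall>x\<in>S. \<forall>y\<in>S. x + y \<in> S) \<and>
    (\<forall>c. \<forall>x\<in>S. c *\<^sub>C x \<in> S) \<and>
    (\<forall>x\<in>S. \<exists>y\<in>S. is_adjoint x y)"

text \<open>An \<open>n \<times> n\<close> matrix over \<open>B(H)\<close> is a function \<open>X :: nat \<Rightarrow> nat \<Rightarrow> 'h bounded_op\<close> of which only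
  the entries \<open>X i j\<close> with \<open>i, j < n\<close> are relevant. It acts on the direct sum of \<open>n\<close> copies of
  \<open>H\<close>, whose elements \<open>\<xi> :: nat \<Rightarrow> 'h\<close> have norm squared \<open>\<Sum>i<n. (norm (\<xi> i))\<^sup>2\<close>; positivity and
  operator norm of \<open>X\<close> refer to this action.\<close>

definition mat_positive :: "nat \<Rightarrow> (nat \<Rightarrow> nat \<Rightarrow> 'h::complex_hilbert bounded_op) \<Rightarrow> bool"
  where "mat_positive n X \<longleftrightarrow>
    (\<forall>\<xi>. (\<Sum>i<n. cinner (\<xi> i) (\<Sum>j<n. X i j \<cdot>\<^sub>o \<xi> j)) \<in> \<real>\<^sub>\<ge>\<^sub>0)"

definition mat_norm :: "nat \<Rightarrow> (nat \<Rightarrow> nat \<Rightarrow> 'h::complex_hilbert bounded_op) \<Rightarrow> real"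
  where "mat_norm n X =
    (SUP \<xi>\<in>{\<xi>. (\<Sum>j<n. (norm (\<xi> j))\<^sup>2) \<le> 1}. sqrt (\<Sum>i<n. (norm (\<Sum>j<n. X i j \<cdot>\<^sub>o \<xi> j))\<^sup>2))"

definition linear_map_on ::
    "'h::complex_hilbert bounded_op set \<Rightarrow> ('h bounded_op \<Rightarrow> 'k::complex_hilbert bounded_op) \<Rightarrow> bool"
  where "linear_map_on S f \<longleftrightarrow>
    (\<forall>x\<in>S. \<forall>y\<in>S. f (x + y) = f x + f y) \<and>
    (\<forall>c. \<forall>x\<in>S. f (c *\<^sub>C x) = c *\<^sub>C f x)"

definition completely_positive_on ::
    "'h::complex_hilbert bounded_op set \<Rightarrow> ('h bounded_op \<Rightarrow> 'k::complex_hilbert bounded_op) \<Rightarrow> bool"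
  where "completely_positive_on S f \<longleftrightarrow>
    (\<forall>n X. (\<forall>i<n. \<forall>j<n. X i j \<in> S) \<longrightarrow> mat_positive n X \<longrightarrow> mat_positive n (\<lambda>i j. f (X i j)))"

definition completely_isometric_on ::
    "'h::complex_hilbert bounded_op set \<Rightarrow> ('h bounded_op \<Rightarrow> 'k::complex_hilbert bounded_op) \<Rightarrow> bool"
  where "completely_isometric_on S f \<longleftrightarrow>
    (\<forall>n X. (\<forall>i<n. \<forall>j<n. X i j \<in> S) \<longrightarrow> mat_norm n (\<lambda>i j. f (X i j)) = mat_norm n X)"

definition ucp_map ::
    "'h::complex_hilbert bounded_op set \<Rightarrow> 'k::complex_hilbert bounded_op set \<Rightarrow>
      ('h bounded_op \<Rightarrow> 'k bounded_op) \<Rightarrow> bool"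
  where "ucp_map S T f \<longleftrightarrow>
    f \<in> S \<rightarrow> T \<and> linear_map_on S f \<and> f 1 = 1 \<and> completely_positive_on S f"

section \<open>Equivariant maps\<close>

text \<open>A group acts on an operator system by unital complete order automorphisms: each \<open>\<alpha> g\<close> is
  unital completely positive, and so is its inverse \<open>\<alpha> (inv g)\<close>.\<close>

definition gamma_operator_system ::
    "('g, 'm) monoid_scheme \<Rightarrow> 'h::complex_hilbert bounded_op set \<Rightarrow>
      ('g \<Rightarrow> 'h bounded_op \<Rightarrow> 'h bounded_op) \<Rightarrow> bool"
  where "gamma_operator_system G S \<alpha> \<longleftrightarrow>
    operator_system S \<and>
    (\<forall>g\<in>carrier G. ucp_map S S (\<alpha> g)) \<and>
    (\<forall>x\<in>S. \<alpha> \<one>\<^bsub>G\<^esub> x = x) \<and>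
    (\<forall>g\<in>carrier G. \<forall>h\<in>carrier G. \<forall>x\<in>S. \<alpha> (g \<otimes>\<^bsub>G\<^esub> h) x = \<alpha> g (\<alpha> h x))"

definition gamma_map ::
    "('g, 'm) monoid_scheme \<Rightarrow>
      'h::complex_hilbert bounded_op set \<Rightarrow> ('g \<Rightarrow> 'h bounded_op \<Rightarrow> 'h bounded_op) \<Rightarrow>
      'k::complex_hilbert bounded_op set \<Rightarrow> ('g \<Rightarrow> 'k bounded_op \<Rightarrow> 'k bounded_op) \<Rightarrow>
      ('h bounded_op \<Rightarrow> 'k bounded_op) \<Rightarrow> bool"
  where "gamma_map G S \<alpha> T \<beta> f \<longleftrightarrow>
    gamma_operator_system G S \<alpha> \<and> gamma_operator_system G T \<beta> \<and>
    ucp_map S T f \<and>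
    (\<forall>g\<in>carrier G. \<forall>x\<in>S. f (\<alpha> g x) = \<beta> g (f x))"

definition gamma_embedding ::
    "('g, 'm) monoid_scheme \<Rightarrow>
      'h::complex_hilbert bounded_op set \<Rightarrow> ('g \<Rightarrow> 'h bounded_op \<Rightarrow> 'h bounded_op) \<Rightarrow>
      'k::complex_hilbert bounded_op set \<Rightarrow> ('g \<Rightarrow> 'k bounded_op \<Rightarrow> 'k bounded_op) \<Rightarrow>
      ('h bounded_op \<Rightarrow> 'k bounded_op) \<Rightarrow> bool"
  where "gamma_embedding G S \<alpha> T \<beta> f \<longleftrightarrow>
    gamma_map G S \<alpha> T \<beta> f \<and> completely_isometric_on S f"

section \<open>Unitary representations and the Furstenberg--Hamana boundary\<close>

definition unitary_op :: "'h::complex_hilbert bounded_op \<Rightarrow> bool"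
  where "unitary_op u \<longleftrightarrow> (\<exists>v. is_adjoint u v \<and> v * u = 1 \<and> u * v = 1)"

definition unitary_group :: "'h::complex_hilbert bounded_op monoid"
  where "unitary_group = \<lparr>carrier = {u. unitary_op u}, mult = (*), one = 1\<rparr>"

definition unitary_rep :: "('g, 'm) monoid_scheme \<Rightarrow> ('g \<Rightarrow> 'h::complex_hilbert bounded_op) \<Rightarrow> bool"
  where "unitary_rep G \<pi> \<longleftrightarrow> group G \<and> \<pi> \<in> hom G unitary_group"

definition conj_action ::
    "('g, 'm) monoid_scheme \<Rightarrow> ('g \<Rightarrow> 'h::complex_hilbert bounded_op) \<Rightarrow>
      'g \<Rightarrow> 'h bounded_op \<Rightarrow> 'h bounded_op"
  where "conj_action G \<pi> g x = \<pi> g * x * \<pi> (inv\<^bsub>G\<^esub> g)"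

definition gamma_self_maps ::
    "('g, 'm) monoid_scheme \<Rightarrow> ('g \<Rightarrow> 'h::complex_hilbert bounded_op) \<Rightarrow>
      ('h bounded_op \<Rightarrow> 'h bounded_op) set"
  where "gamma_self_maps G \<pi> = {\<phi>. gamma_map G UNIV (conj_action G \<pi>) UNIV (conj_action G \<pi>) \<phi>}"

definition fh_le ::
    "('h::complex_hilbert bounded_op \<Rightarrow> 'h bounded_op) \<Rightarrow> ('h bounded_op \<Rightarrow> 'h bounded_op) \<Rightarrow> bool"
  where "fh_le \<phi> \<psi> \<longleftrightarrow> (\<forall>x. norm (\<phi> x) \<le> norm (\<psi> x))"

text \<open>Minimality with respect to the preorder \<open>fh_le\<close>, which is not antisymmetric.\<close>

definition fh_minimal ::
    "('g, 'm) monoid_scheme \<Rightarrow> ('g \<Rightarrow> 'h::complex_hilbert bounded_op) \<Rightarrow>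
      ('h bounded_op \<Rightarrow> 'h bounded_op) \<Rightarrow> bool"
  where "fh_minimal G \<pi> \<phi> \<longleftrightarrow>
    \<phi> \<in> gamma_self_maps G \<pi> \<and> (\<forall>\<psi>\<in>gamma_self_maps G \<pi>. fh_le \<psi> \<phi> \<longrightarrow> fh_le \<phi> \<psi>)"

text \<open>The boundary realised by a minimal \<open>\<phi>\<close>, with the Choi--Effros product. Its linear structure,
  matrix order and matrix norms are those of the ambient \<open>B(H)\<close>; by the Choi--Effros theorem they
  are also the ones belonging to the C*-algebra with this product.\<close>

definition fh_boundary :: "('h::complex_hilbert bounded_op \<Rightarrow> 'h bounded_op) \<Rightarrow> 'h bounded_op monoid"
  where "fh_boundary \<phi> = \<lparr>carrier = range \<phi>, mult = (\<lambda>a b. \<phi> (a * b)), one = 1\<rparr>"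

end

theory Submission
  imports Defs
begin

text \<open>Let \<open>\<phi>\<close> be minimal for the group and \<open>\<psi>\<close> minimal for the subgroup. The embedding is the
  restriction of \<open>\<phi>\<close> to the image of \<open>\<psi>\<close>. It is equivariant for the subgroup, since \<open>\<phi>\<close> is
  equivariant for the whole group. Both \<open>\<phi>\<close> and \<open>\<psi>\<close>, being unital and completely positive, are
  completely contractive; so the restriction is completely isometric as soon as \<open>\<psi>\<close> is a left
  inverse of \<open>\<phi>\<close> on the image of \<open>\<psi>\<close> (lemma \<open>fh_minimal_left_inverse\<close>).

  This is a rigidity property of the minimal map \<open>\<psi>\<close>. Let \<open>\<tau>\<close> be an equivariant self map with
  \<open>\<tau> \<le> \<psi>\<close>. Each average \<open>(\<tau> + \<dots> + \<tau>^n) / n\<close> is again an equivariant self map below \<open>\<psi>\<close>, so by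
  minimality it has the same norm as \<open>\<psi>\<close> at every point. At \<open>x - \<tau> x\<close> the averages telescope to
  \<open>(\<tau> x - \<tau>^(n+1) x) / n\<close>, which tends to \<open>0\<close> in norm; hence \<open>\<psi> (\<tau> x) = \<psi> x\<close> (lemma
  \<open>fh_minimal_absorb\<close>). No limit point of the averages is needed. With \<open>\<tau> = \<psi>\<close> this says that \<open>\<psi>\<close>
  is idempotent, and with \<open>\<tau> = \<psi> \<circ> \<phi> \<circ> \<psi>\<close> it then says that \<open>\<psi> \<circ> \<phi> \<circ> \<psi> = \<psi>\<close>.

  Complete contractivity (lemma \<open>mat_norm_ucp_le\<close>) comes from the usual two-by-two block matrix: for
  \<open>c > 0\<close>, the matrix with diagonal blocks \<open>c\<close> and off-diagonal blocks \<open>X\<close> and its adjoint is positive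
  exactly when \<open>X\<close> has norm at most \<open>c\<close>.\<close>

section \<open>Inner products and the action of operators\<close>

lemma cinner_add_left: "cinner (x + y) z = cinner x z + cinner y (z::'h::complex_hilbert)"
  by (metis cinner_commute cinner_add_right complex_cnj_add)

lemma cinner_scaleC_left: "cinner (c *\<^sub>C x) (z::'h::complex_hilbert) = cnj c * cinner x z"
  by (metis cinner_commute cinner_scaleC_right complex_cnj_mult)

lemma cinner_scaleR_right: "cinner x (r *\<^sub>R (z::'h::complex_hilbert)) = of_real r * cinner x z"
  by (simp add: scaleR_scaleC cinner_scaleC_right)

lemma cinner_scaleR_left: "cinner (r *\<^sub>R x) (z::'h::complex_hilbert) = of_real r * cinner x z"
  by (simp add: scaleR_scaleC cinner_scaleC_left)

lemma cinner_zero_right [simp]: "cinner x (0::'h::complex_hilbert) = 0"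
  using cinner_add_right[of x 0 0] by simp

lemma cinner_zero_left [simp]: "cinner (0::'h::complex_hilbert) x = 0"
  using cinner_add_left[of 0 0 x] by simp

lemma cinner_sum_right: "cinner x (\<Sum>i\<in>A. f i) = (\<Sum>i\<in>A. cinner x (f i :: 'h::complex_hilbert))"
  by (induction A rule: infinite_finite_induct) (auto simp: cinner_add_right)

lemma cinner_sum_left: "cinner (\<Sum>i\<in>A. f i) x = (\<Sum>i\<in>A. cinner (f i) (x :: 'h::complex_hilbert))"
  by (induction A rule: infinite_finite_induct) (auto simp: cinner_add_left)

lemma norm_add_square:
  "(norm (x + y :: 'h::complex_hilbert))\<^sup>2 = (norm x)\<^sup>2 + (norm y)\<^sup>2 + 2 * Re (cinner x y)"
proof -
  have "complex_of_real ((norm (x + y))\<^sup>2)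
      = of_real ((norm x)\<^sup>2) + of_real ((norm y)\<^sup>2) + (cinner x y + cinner y x)"
    unfolding cinner_self[symmetric] by (simp add: cinner_add_left cinner_add_right)
  also have "cinner y x = cnj (cinner x y)"
    by (rule cinner_commute)
  finally have "Re (complex_of_real ((norm (x + y))\<^sup>2))
      = Re (of_real ((norm x)\<^sup>2) + of_real ((norm y)\<^sup>2) + (cinner x y + cnj (cinner x y)))"
    by (rule arg_cong)
  then show ?thesis by simp
qed

lemma op_apply_add: "(x + y) \<cdot>\<^sub>o \<xi> = x \<cdot>\<^sub>o \<xi> + y \<cdot>\<^sub>o \<xi>"
  by transfer (simp add: blinfun.bilinear_simps)

lemma op_apply_scaleR: "(r *\<^sub>R x) \<cdot>\<^sub>o \<xi> = r *\<^sub>R (x \<cdot>\<^sub>o \<xi>)"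
  by transfer (simp add: blinfun.bilinear_simps)

lemma op_apply_zero [simp]: "0 \<cdot>\<^sub>o \<xi> = 0"
  by transfer simp

lemma op_apply_one [simp]: "1 \<cdot>\<^sub>o \<xi> = \<xi>"
  by transfer simp

lemma op_apply_sum: "(\<Sum>k\<in>A. x k) \<cdot>\<^sub>o \<xi> = (\<Sum>k\<in>A. x k \<cdot>\<^sub>o \<xi>)"
  by (induction A rule: infinite_finite_induct) (auto simp: op_apply_add)

lemma op_apply_add_right: "x \<cdot>\<^sub>o (\<xi> + \<eta>) = x \<cdot>\<^sub>o \<xi> + x \<cdot>\<^sub>o \<eta>"
  by transfer (simp add: blinfun.bilinear_simps)

lemma op_apply_scaleC_right: "x \<cdot>\<^sub>o (c *\<^sub>C \<xi>) = c *\<^sub>C (x \<cdot>\<^sub>o \<xi>)"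
  by transfer simp

lemma op_apply_scaleR_right: "x \<cdot>\<^sub>o (r *\<^sub>R \<xi>) = r *\<^sub>R (x \<cdot>\<^sub>o \<xi>)"
  by transfer (simp add: blinfun.bilinear_simps)

lemma op_apply_zero_right [simp]: "x \<cdot>\<^sub>o 0 = 0"
  by transfer simp

lemma norm_op_apply_le: "norm (x \<cdot>\<^sub>o \<xi>) \<le> norm x * norm \<xi>"
  by transfer (rule norm_blinfun)

lemma norm_op_le: "norm x \<le> c" if "0 \<le> c" "\<And>\<xi>. norm (x \<cdot>\<^sub>o \<xi>) \<le> c * norm \<xi>"
  using that by transfer (rule norm_blinfun_bound)

section \<open>Positive operator matrices\<close>

text \<open>The sesquilinear form of an operator matrix.\<close>

definition mat_form ::
    "nat \<Rightarrow> (nat \<Rightarrow> nat \<Rightarrow> 'h::complex_hilbert bounded_op) \<Rightarrow> (nat \<Rightarrow> 'h) \<Rightarrow> (nat \<Rightarrow> 'h) \<Rightarrow> complex"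
  where "mat_form n Z u v = (\<Sum>i<n. \<Sum>j<n. cinner (u i) (Z i j \<cdot>\<^sub>o v j))"

lemma mat_positive_iff_form:
  "mat_positive n Z \<longleftrightarrow> (\<forall>u. mat_form n Z u u \<in> \<real>\<^sub>\<ge>\<^sub>0)"
  by (simp add: mat_positive_def mat_form_def cinner_sum_right)

lemma mat_form_add_left: "mat_form n Z (\<lambda>i. u i + v i) w = mat_form n Z u w + mat_form n Z v w"
  by (simp add: mat_form_def cinner_add_left sum.distrib)

lemma mat_form_add_right: "mat_form n Z w (\<lambda>i. u i + v i) = mat_form n Z w u + mat_form n Z w v"
  by (simp add: mat_form_def op_apply_add_right cinner_add_right sum.distrib)

lemma mat_form_scaleC_left: "mat_form n Z (\<lambda>i. c *\<^sub>C u i) w = cnj c * mat_form n Z u w"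
  by (simp add: mat_form_def cinner_scaleC_left sum_distrib_left)

lemma mat_form_scaleC_right: "mat_form n Z w (\<lambda>i. c *\<^sub>C u i) = c * mat_form n Z w u"
  by (simp add: mat_form_def op_apply_scaleC_right cinner_scaleC_right sum_distrib_left)

text \<open>A positive matrix has a Hermitian form, by polarization.\<close>

lemma mat_form_hermitian:
  assumes "mat_positive n Z"
  shows "mat_form n Z u v = cnj (mat_form n Z v u)"
proof -
  let ?Q = "mat_form n Z"
  have real: "Im (?Q w w) = 0" for w
    using assms by (simp add: mat_positive_iff_form complex_nonneg_Reals_iff)
  have "?Q (\<lambda>i. u i + v i) (\<lambda>i. u i + v i) = ?Q u u + ?Q u v + ?Q v u + ?Q v v"
    by (simp add: mat_form_add_left mat_form_add_right)
  then have 1: "Im (?Q u v) + Im (?Q v u) = 0"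
    using real[of "\<lambda>i. u i + v i"] real[of u] real[of v] by simp
  have "?Q (\<lambda>i. u i + \<i> *\<^sub>C v i) (\<lambda>i. u i + \<i> *\<^sub>C v i) = ?Q u u + \<i> * ?Q u v - \<i> * ?Q v u + ?Q v v"
    by (simp add: mat_form_add_left mat_form_add_right mat_form_scaleC_left mat_form_scaleC_right
        algebra_simps)
  then have 2: "Re (?Q u v) = Re (?Q v u)"
    using real[of "\<lambda>i. u i + \<i> *\<^sub>C v i"] real[of u] real[of v] by simp
  from 1 2 show ?thesis by (simp add: complex_eq_iff)
qed

lemma mat_positive_adjoint:
  assumes pos: "mat_positive n Z" and "i < n" "j < n"
  shows "is_adjoint (Z i j) (Z j i)"
  unfolding is_adjoint_def
proof (intro allI)
  fix \<xi> \<eta>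
  have single: "mat_form n Z (\<lambda>m. if m = k then \<alpha> else 0) (\<lambda>m. if m = l then \<beta> else 0)
      = cinner \<alpha> (Z k l \<cdot>\<^sub>o \<beta>)" if "k < n" "l < n" for k l \<alpha> \<beta>
  proof -
    have "cinner (if a = k then \<alpha> else 0) (Z a b \<cdot>\<^sub>o (if b = l then \<beta> else 0))
        = (if a = k then if b = l then cinner \<alpha> (Z k l \<cdot>\<^sub>o \<beta>) else 0 else 0)" for a b
      by simp
    then have "mat_form n Z (\<lambda>m. if m = k then \<alpha> else 0) (\<lambda>m. if m = l then \<beta> else 0)
        = (\<Sum>a<n. \<Sum>b<n. if a = k then if b = l then cinner \<alpha> (Z k l \<cdot>\<^sub>o \<beta>) else 0 else 0)"
      by (simp only: mat_form_def)
    also have "\<dots> = (\<Sum>a<n. if a = k then cinner \<alpha> (Z k l \<cdot>\<^sub>o \<beta>) else 0)"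
      using that by (intro sum.cong) auto
    finally show ?thesis using that by simp
  qed
  have "cinner (Z i j \<cdot>\<^sub>o \<xi>) \<eta> = cnj (cinner \<eta> (Z i j \<cdot>\<^sub>o \<xi>))"
    by (rule cinner_commute)
  also have "\<dots> = cinner \<xi> (Z j i \<cdot>\<^sub>o \<eta>)"
    using mat_form_hermitian[OF pos, of "\<lambda>m. if m = j then \<xi> else 0" "\<lambda>m. if m = i then \<eta> else 0"]
    by (simp add: single assms(2,3))
  finally show "cinner (Z i j \<cdot>\<^sub>o \<xi>) \<eta> = cinner \<xi> (Z j i \<cdot>\<^sub>o \<eta>)" .
qed

text \<open>The \<open>2n \<times> 2n\<close> matrix with the scalar \<open>c\<close> as diagonal blocks, \<open>X\<close> in the upper right and \<open>Y\<close>
  in the lower left corner.\<close>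

definition block_mat ::
    "nat \<Rightarrow> real \<Rightarrow> (nat \<Rightarrow> nat \<Rightarrow> 'h::complex_hilbert bounded_op) \<Rightarrow> (nat \<Rightarrow> nat \<Rightarrow> 'h bounded_op) \<Rightarrow>
      nat \<Rightarrow> nat \<Rightarrow> 'h bounded_op"
  where "block_mat n c X Y i j =
    (if i < n \<and> n \<le> j then X i (j - n) else if n \<le> i \<and> j < n then Y (i - n) j
     else if i = j then c *\<^sub>R 1 else 0)"

lemma sum_lessThan_double:
  "(\<Sum>i<n + m. f i) = (\<Sum>i<n. f i) + (\<Sum>i<m. f (n + i) :: 'a::comm_monoid_add)"
  for n m :: nat
  by (induction m) (auto simp: add.assoc)

text \<open>Completing the square in the form of the block matrix. The vector \<open>u\<close> has the halves \<open>u i\<close> and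
  \<open>u (n + i)\<close> for \<open>i < n\<close>, and \<open>y u\<close> is the image of its lower half under \<open>X\<close>.\<close>

lemma block_mat_form:
  fixes X Y :: "nat \<Rightarrow> nat \<Rightarrow> 'h::complex_hilbert bounded_op"
  assumes c: "0 < c"
    and adj: "\<And>i j. i < n \<Longrightarrow> j < n \<Longrightarrow> is_adjoint (X i j) (Y j i)"
  defines "y b i \<equiv> \<Sum>j<n. X i j \<cdot>\<^sub>o b (n + j)"
  shows "mat_form (n + n) (block_mat n c X Y) u u = of_real
    (((\<Sum>i<n. (norm (c *\<^sub>R u i + y u i))\<^sup>2)
      + (c\<^sup>2 * (\<Sum>j<n. (norm (u (n + j)))\<^sup>2) - (\<Sum>i<n. (norm (y u i))\<^sup>2))) / c)"
proof -
  define q where "q = (\<Sum>i<n. cinner (u i) (y u i))"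
  define A where "A = (\<Sum>i<n. (norm (u i))\<^sup>2)"
  define B where "B = (\<Sum>j<n. (norm (u (n + j)))\<^sup>2)"
  define D where "D = (\<Sum>i<n. (norm (y u i))\<^sup>2)"
  have diag: "(\<Sum>i<n. \<Sum>j<n. cinner (w i) ((if i = j then c *\<^sub>R 1 else 0) \<cdot>\<^sub>o w j))
      = of_real c * of_real (\<Sum>i<n. (norm (w i))\<^sup>2)" for w :: "nat \<Rightarrow> 'h"
  proof -
    have "(\<Sum>j<n. cinner (w i) ((if i = j then c *\<^sub>R 1 else 0) \<cdot>\<^sub>o w j))
        = of_real c * cinner (w i) (w i)" if "i < n" for i
    proof -
      have "(\<Sum>j<n. cinner (w i) ((if i = j then c *\<^sub>R 1 else 0) \<cdot>\<^sub>o w j))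
          = (\<Sum>j<n. if i = j then of_real c * cinner (w i) (w i) else 0)"
        by (rule sum.cong) (auto simp: op_apply_scaleR cinner_scaleR_right)
      then show ?thesis using that by simp
    qed
    then show ?thesis by (simp add: cinner_self sum_distrib_left)
  qed
  have lower: "(\<Sum>i<n. \<Sum>j<n. cinner (u (n + i)) (Y i j \<cdot>\<^sub>o u j)) = cnj q"
  proof -
    have "(\<Sum>i<n. \<Sum>j<n. cinner (u (n + i)) (Y i j \<cdot>\<^sub>o u j))
        = (\<Sum>i<n. \<Sum>j<n. cinner (X j i \<cdot>\<^sub>o u (n + i)) (u j))"
      using adj by (simp add: is_adjoint_def)
    also have "\<dots> = (\<Sum>j<n. cinner (y u j) (u j))"
      by (subst sum.swap) (simp add: y_def cinner_sum_left)
    also have "\<dots> = cnj q"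
      unfolding q_def cnj_sum by (metis cinner_commute)
    finally show ?thesis .
  qed
  have "mat_form (n + n) (block_mat n c X Y) u u
      = (\<Sum>i<n. \<Sum>j<n. cinner (u i) ((if i = j then c *\<^sub>R 1 else 0) \<cdot>\<^sub>o u j))
        + (\<Sum>i<n. \<Sum>j<n. cinner (u i) (X i j \<cdot>\<^sub>o u (n + j)))
        + ((\<Sum>i<n. \<Sum>j<n. cinner (u (n + i)) (Y i j \<cdot>\<^sub>o u j))
        + (\<Sum>i<n. \<Sum>j<n. cinner (u (n + i)) ((if i = j then c *\<^sub>R 1 else 0) \<cdot>\<^sub>o u (n + j))))"
    unfolding mat_form_def sum_lessThan_double sum.distrib
    by (simp add: block_mat_def cong: if_cong)
  also have "\<dots> = of_real c * of_real A + q + (cnj q + of_real c * of_real B)"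
    using diag[of u] diag[of "\<lambda>i. u (n + i)"] lower
    by (simp add: A_def B_def q_def y_def cinner_sum_right)
  also have "\<dots> = of_real (c * A + 2 * Re q + c * B)"
    by (simp add: complex_eq_iff)
  also have "c * A + 2 * Re q + c * B = ((c\<^sup>2 * A + D + 2 * c * Re q) + (c\<^sup>2 * B - D)) / c"
    using c by (simp add: field_simps power2_eq_square)
  also have "c\<^sup>2 * A + D + 2 * c * Re q = (\<Sum>i<n. (norm (c *\<^sub>R u i + y u i))\<^sup>2)"
    by (simp add: A_def D_def q_def norm_add_square cinner_scaleR_left sum.distrib
        sum_distrib_left power_mult_distrib mult.assoc)
  finally show ?thesis by (simp add: B_def D_def)
qed

lemma mat_positive_block_iff:
  fixes X Y :: "nat \<Rightarrow> nat \<Rightarrow> 'h::complex_hilbert bounded_op"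
  assumes c: "0 < c"
    and adj: "\<And>i j. i < n \<Longrightarrow> j < n \<Longrightarrow> is_adjoint (X i j) (Y j i)"
  shows "mat_positive (n + n) (block_mat n c X Y) \<longleftrightarrow>
    (\<forall>\<xi>. (\<Sum>i<n. (norm (\<Sum>j<n. X i j \<cdot>\<^sub>o \<xi> j))\<^sup>2) \<le> c\<^sup>2 * (\<Sum>j<n. (norm (\<xi> j))\<^sup>2))"
    (is "?P \<longleftrightarrow> ?R")
proof
  assume P: ?P
  show ?R
  proof
    fix \<xi> :: "nat \<Rightarrow> 'h"
    define y where "y i = (\<Sum>j<n. X i j \<cdot>\<^sub>o \<xi> j)" for i
    \<comment> \<open>The upper half is chosen to make the completed square vanish.\<close>
    define u where "u i = (if i < n then - (1 / c) *\<^sub>R y i else \<xi> (i - n))" for i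
    have "0 \<le> Re (mat_form (n + n) (block_mat n c X Y) u u)"
      using P by (simp add: mat_positive_iff_form complex_nonneg_Reals_iff)
    also have "Re (mat_form (n + n) (block_mat n c X Y) u u)
        = (c\<^sup>2 * (\<Sum>j<n. (norm (\<xi> j))\<^sup>2) - (\<Sum>i<n. (norm (y i))\<^sup>2)) / c"
      using c by (simp add: block_mat_form[OF c adj] u_def y_def[symmetric])
    finally show "(\<Sum>i<n. (norm (\<Sum>j<n. X i j \<cdot>\<^sub>o \<xi> j))\<^sup>2) \<le> c\<^sup>2 * (\<Sum>j<n. (norm (\<xi> j))\<^sup>2)"
      using c by (simp add: y_def zero_le_divide_iff)
  qed
next
  assume R: ?R
  show ?P
    unfolding mat_positive_iff_form
  proof
    fix u
    have "0 \<le> c\<^sup>2 * (\<Sum>j<n. (norm (u (n + j)))\<^sup>2)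
        - (\<Sum>i<n. (norm (\<Sum>j<n. X i j \<cdot>\<^sub>o u (n + j)))\<^sup>2)"
      using R[rule_format, of "\<lambda>j. u (n + j)"] by simp
    then show "mat_form (n + n) (block_mat n c X Y) u u \<in> \<real>\<^sub>\<ge>\<^sub>0"
      using c by (subst block_mat_form[OF c adj])
        (auto simp only: nonneg_Reals_of_real_iff
          intro!: divide_nonneg_pos add_nonneg_nonneg sum_nonneg zero_le_power2)
  qed
qed

section \<open>The norm of an operator matrix\<close>

lemma mat_norm_cong:
  assumes "\<And>i j. i < n \<Longrightarrow> j < n \<Longrightarrow> X i j = Y i j"
  shows "mat_norm n X = mat_norm n Y"
  using assms by (simp add: mat_norm_def)

lemma mat_norm_bdd_above:
  fixes X :: "nat \<Rightarrow> nat \<Rightarrow> 'h::complex_hilbert bounded_op"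
  shows "bdd_above ((\<lambda>\<xi>. sqrt (\<Sum>i<n. (norm (\<Sum>j<n. X i j \<cdot>\<^sub>o \<xi> j))\<^sup>2))
    ` {\<xi>. (\<Sum>j<n. (norm (\<xi> j))\<^sup>2) \<le> 1})"
proof (rule bdd_aboveI2)
  fix \<xi> :: "nat \<Rightarrow> 'h"
  assume "\<xi> \<in> {\<xi>. (\<Sum>j<n. (norm (\<xi> j))\<^sup>2) \<le> 1}"
  then have le: "(\<Sum>j<n. (norm (\<xi> j))\<^sup>2) \<le> 1" by simp
  have *: "norm (\<xi> j) \<le> 1" if "j < n" for j
  proof -
    have "(norm (\<xi> j))\<^sup>2 \<le> (\<Sum>j<n. (norm (\<xi> j))\<^sup>2)"
      using that by (intro member_le_sum) auto
    with le have "(norm (\<xi> j))\<^sup>2 \<le> 1\<^sup>2" by simp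
    then show ?thesis by (rule power2_le_imp_le) simp
  qed
  have "norm (\<Sum>j<n. X i j \<cdot>\<^sub>o \<xi> j) \<le> (\<Sum>j<n. norm (X i j))" for i
  proof (rule sum_norm_le)
    fix j assume "j \<in> {..<n}"
    then have "norm (X i j) * norm (\<xi> j) \<le> norm (X i j)"
      using * by (intro mult_left_le) auto
    then show "norm (X i j \<cdot>\<^sub>o \<xi> j) \<le> norm (X i j)"
      using norm_op_apply_le order_trans by blast
  qed
  then show "sqrt (\<Sum>i<n. (norm (\<Sum>j<n. X i j \<cdot>\<^sub>o \<xi> j))\<^sup>2) \<le> sqrt (\<Sum>i<n. (\<Sum>j<n. norm (X i j))\<^sup>2)"
    by (intro real_sqrt_le_mono sum_mono power_mono) auto
qed

lemma mat_norm_nonneg: "0 \<le> mat_norm n X"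
proof -
  have "sqrt (\<Sum>i<n. (norm (\<Sum>j<n. X i j \<cdot>\<^sub>o 0))\<^sup>2) \<le> mat_norm n X"
    unfolding mat_norm_def by (rule cSUP_upper[OF _ mat_norm_bdd_above]) simp
  then show ?thesis by simp
qed

lemma mat_norm_bound:
  fixes X :: "nat \<Rightarrow> nat \<Rightarrow> 'h::complex_hilbert bounded_op"
  shows "(\<Sum>i<n. (norm (\<Sum>j<n. X i j \<cdot>\<^sub>o \<xi> j))\<^sup>2) \<le> (mat_norm n X)\<^sup>2 * (\<Sum>j<n. (norm (\<xi> j))\<^sup>2)"
proof -
  define s where "s = (\<Sum>j<n. (norm (\<xi> j))\<^sup>2)"
  have s0: "0 \<le> s" by (simp add: s_def sum_nonneg)
  show ?thesis
  proof (cases "s = 0")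
    case True
    then have "\<xi> j = 0" if "j < n" for j
      using that by (simp add: s_def sum_nonneg_eq_0_iff)
    then show ?thesis by simp
  next
    case False
    define r where "r = 1 / sqrt s"
    have r: "r\<^sup>2 = 1 / s" using s0 by (simp add: r_def power_divide)
    have "(\<Sum>j<n. (norm (r *\<^sub>R \<xi> j))\<^sup>2) = r\<^sup>2 * s"
      by (simp add: power_mult_distrib s_def sum_distrib_left)
    also have "\<dots> = 1" using False by (simp add: r)
    finally have unit: "(\<Sum>j<n. (norm (r *\<^sub>R \<xi> j))\<^sup>2) \<le> 1" by simp
    have "sqrt (\<Sum>i<n. (norm (\<Sum>j<n. X i j \<cdot>\<^sub>o (r *\<^sub>R \<xi> j)))\<^sup>2) \<le> mat_norm n X"
      unfolding mat_norm_def by (rule cSUP_upper[OF _ mat_norm_bdd_above]) (use unit in simp)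
    then have "(\<Sum>i<n. (norm (\<Sum>j<n. X i j \<cdot>\<^sub>o (r *\<^sub>R \<xi> j)))\<^sup>2) \<le> (mat_norm n X)\<^sup>2"
      by (rule sqrt_le_D)
    also have "(\<Sum>i<n. (norm (\<Sum>j<n. X i j \<cdot>\<^sub>o (r *\<^sub>R \<xi> j)))\<^sup>2)
        = r\<^sup>2 * (\<Sum>i<n. (norm (\<Sum>j<n. X i j \<cdot>\<^sub>o \<xi> j))\<^sup>2)"
      by (simp only: op_apply_scaleR_right scaleR_right.sum[symmetric] norm_scaleR
          power_mult_distrib power2_abs sum_distrib_left)
    finally show ?thesis
      using False s0 unfolding s_def[symmetric] by (simp add: r field_simps)
  qed
qed

lemma mat_norm_le:
  fixes X :: "nat \<Rightarrow> nat \<Rightarrow> 'h::complex_hilbert bounded_op"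
  assumes "0 \<le> c"
    and le: "\<And>\<xi>. (\<Sum>i<n. (norm (\<Sum>j<n. X i j \<cdot>\<^sub>o \<xi> j))\<^sup>2) \<le> c\<^sup>2 * (\<Sum>j<n. (norm (\<xi> j))\<^sup>2)"
  shows "mat_norm n X \<le> c"
  unfolding mat_norm_def
proof (rule cSUP_least)
  have "(\<lambda>_. 0) \<in> {\<xi>::nat \<Rightarrow> 'h. (\<Sum>j<n. (norm (\<xi> j))\<^sup>2) \<le> 1}"
    by simp
  then show "{\<xi>::nat \<Rightarrow> 'h. (\<Sum>j<n. (norm (\<xi> j))\<^sup>2) \<le> 1} \<noteq> {}"
    by (metis empty_iff)
next
  fix \<xi> :: "nat \<Rightarrow> 'h"
  assume "\<xi> \<in> {\<xi>. (\<Sum>j<n. (norm (\<xi> j))\<^sup>2) \<le> 1}"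
  then have "c\<^sup>2 * (\<Sum>j<n. (norm (\<xi> j))\<^sup>2) \<le> c\<^sup>2"
    by (intro mult_left_le) auto
  with le[of \<xi>] have "(\<Sum>i<n. (norm (\<Sum>j<n. X i j \<cdot>\<^sub>o \<xi> j))\<^sup>2) \<le> c\<^sup>2" by linarith
  then show "sqrt (\<Sum>i<n. (norm (\<Sum>j<n. X i j \<cdot>\<^sub>o \<xi> j))\<^sup>2) \<le> c"
    using \<open>0 \<le> c\<close> by (simp add: real_le_lsqrt)
qed

lemma mat_norm_1: "mat_norm 1 (\<lambda>_ _. x) = norm x"
proof (rule antisym)
  show "mat_norm 1 (\<lambda>_ _. x) \<le> norm x"
    by (rule mat_norm_le) (auto simp: norm_op_apply_le simp flip: power_mult_distrib intro!: power_mono)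
  show "norm x \<le> mat_norm 1 (\<lambda>_ _. x)"
  proof (rule norm_op_le[OF mat_norm_nonneg])
    fix \<xi>
    have "(norm (x \<cdot>\<^sub>o \<xi>))\<^sup>2 \<le> (mat_norm 1 (\<lambda>_ _. x) * norm \<xi>)\<^sup>2"
      using mat_norm_bound[where n = 1 and X = "\<lambda>_ _. x" and \<xi> = "\<lambda>_. \<xi>"] by (simp add: power_mult_distrib)
    then show "norm (x \<cdot>\<^sub>o \<xi>) \<le> mat_norm 1 (\<lambda>_ _. x) * norm \<xi>"
      by (rule power2_le_imp_le) (simp add: mat_norm_nonneg)
  qed
qed

section \<open>Unital completely positive maps are completely contractive\<close>

lemma linear_map_on_UNIV_simps:
  assumes "linear_map_on UNIV f"
  shows "f (x + y) = f x + f y" "f (c *\<^sub>C x) = c *\<^sub>C f x" "f (r *\<^sub>R x) = r *\<^sub>R f x"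
    "f 0 = 0" "f (x - y) = f x - f y"
proof -
  show add: "f (x + y) = f x + f y" for x y
    using assms by (simp add: linear_map_on_def)
  show "f (c *\<^sub>C x) = c *\<^sub>C f x" for c x
    using assms by (simp add: linear_map_on_def)
  then show "f (r *\<^sub>R x) = r *\<^sub>R f x" by (simp add: scaleR_scaleC)
  show "f 0 = 0" using add[of 0 0] by simp
  show "f (x - y) = f x - f y" using add[of "x - y" y] by (simp add: algebra_simps)
qed

lemma linear_map_on_UNIV_sum:
  assumes "linear_map_on UNIV f"
  shows "f (\<Sum>k\<in>A. x k) = (\<Sum>k\<in>A. f (x k))"
  by (induction A rule: infinite_finite_induct) (auto simp: linear_map_on_UNIV_simps[OF assms])

lemma ucp_map_block_mat:
  assumes f: "ucp_map UNIV T f" and "mat_positive m (block_mat n c X Y)"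
  shows "mat_positive m (block_mat n c (\<lambda>i j. f (X i j)) (\<lambda>i j. f (Y i j)))"
proof -
  have lin: "linear_map_on UNIV f" and one: "f 1 = 1" using f by (auto simp: ucp_map_def)
  have eq: "(\<lambda>i j. f (block_mat n c X Y i j)) = block_mat n c (\<lambda>i j. f (X i j)) (\<lambda>i j. f (Y i j))"
    by (intro ext) (auto simp: block_mat_def linear_map_on_UNIV_simps[OF lin] one)
  show ?thesis
    unfolding eq[symmetric] using assms by (simp add: ucp_map_def completely_positive_on_def)
qed

lemma ucp_map_adjoint:
  assumes f: "ucp_map UNIV T f" and adj: "is_adjoint x y"
  shows "is_adjoint (f x) (f y)"
proof -
  \<comment> \<open>Any \<open>c > 0\<close> with \<open>norm x \<le> c\<close> makes the block matrix positive, and the off-diagonal entries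
    of a positive matrix are adjoint to each other.\<close>
  define c where "c = norm x + 1"
  have c: "0 < c" by (simp add: c_def add_nonneg_pos)
  have "(norm (x \<cdot>\<^sub>o \<xi>))\<^sup>2 \<le> (c * norm \<xi>)\<^sup>2" for \<xi>
  proof (rule power_mono)
    show "norm (x \<cdot>\<^sub>o \<xi>) \<le> c * norm \<xi>"
      using norm_op_apply_le[of x \<xi>] norm_ge_zero[of \<xi>] unfolding c_def distrib_right by linarith
  qed simp
  then have "mat_positive (1 + 1) (block_mat 1 c (\<lambda>_ _. x) (\<lambda>_ _. y))"
    using adj by (subst mat_positive_block_iff[OF c]) (auto simp: power_mult_distrib)
  then have "mat_positive (1 + 1) (block_mat 1 c (\<lambda>_ _. f x) (\<lambda>_ _. f y))"
    by (rule ucp_map_block_mat[OF f])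
  from mat_positive_adjoint[OF this, of 0 1] show ?thesis
    by (simp add: block_mat_def)
qed

text \<open>The adjoints that the block matrix needs exist because \<open>B(H)\<close> is assumed to be an operator
  system; this avoids the Riesz representation theorem.\<close>

lemma mat_norm_ucp_le:
  fixes f :: "'h::complex_hilbert bounded_op \<Rightarrow> 'k::complex_hilbert bounded_op"
  assumes f: "ucp_map UNIV T f" and os: "operator_system (UNIV :: 'h bounded_op set)"
  shows "mat_norm n (\<lambda>i j. f (X i j)) \<le> mat_norm n X"
proof (rule dense_ge)
  fix c assume less: "mat_norm n X < c"
  then have c: "0 < c" using mat_norm_nonneg[of n X] by linarith
  have "\<forall>x::'h bounded_op. \<exists>y. is_adjoint x y"
    using os by (simp add: operator_system_def)
  then obtain adj :: "'h bounded_op \<Rightarrow> 'h bounded_op" where adj: "is_adjoint x (adj x)" for x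
    by metis
  define Y where "Y i j = adj (X j i)" for i j
  have Y: "is_adjoint (X j i) (Y i j)" for i j by (simp add: Y_def adj)
  have "(\<Sum>i<n. (norm (\<Sum>j<n. X i j \<cdot>\<^sub>o \<xi> j))\<^sup>2) \<le> c\<^sup>2 * (\<Sum>j<n. (norm (\<xi> j))\<^sup>2)" for \<xi>
  proof -
    have "(mat_norm n X)\<^sup>2 * (\<Sum>j<n. (norm (\<xi> j))\<^sup>2) \<le> c\<^sup>2 * (\<Sum>j<n. (norm (\<xi> j))\<^sup>2)"
      using less mat_norm_nonneg[of n X] by (intro mult_right_mono power_mono sum_nonneg) auto
    with mat_norm_bound[where n = n and X = X and \<xi> = \<xi>] show ?thesis by linarith
  qed
  then have "mat_positive (n + n) (block_mat n c X Y)"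
    by (subst mat_positive_block_iff[OF c Y]) blast
  then have "mat_positive (n + n) (block_mat n c (\<lambda>i j. f (X i j)) (\<lambda>i j. f (Y i j)))"
    by (rule ucp_map_block_mat[OF f])
  then show "mat_norm n (\<lambda>i j. f (X i j)) \<le> c"
    using c by (subst (asm) mat_positive_block_iff[OF c ucp_map_adjoint[OF f Y]])
      (auto intro!: mat_norm_le)
qed

lemma norm_ucp_le:
  fixes f :: "'h::complex_hilbert bounded_op \<Rightarrow> 'k::complex_hilbert bounded_op"
  assumes "ucp_map UNIV T f" and "operator_system (UNIV :: 'h bounded_op set)"
  shows "norm (f x) \<le> norm x"
  using mat_norm_ucp_le[OF assms, of 1 "\<lambda>_ _. x"] by (simp only: mat_norm_1)

section \<open>Equivariant maps\<close>

lemma ucp_map_subset: "ucp_map S T f \<Longrightarrow> S' \<subseteq> S \<Longrightarrow> f ` S' \<subseteq> T' \<Longrightarrow> ucp_map S' T' f"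
  unfolding ucp_map_def linear_map_on_def completely_positive_on_def
  by (auto simp: subset_iff; blast)

lemma gamma_map_comp:
  fixes f :: "'h::complex_hilbert bounded_op \<Rightarrow> 'k::complex_hilbert bounded_op"
  assumes "gamma_map G S \<alpha> T \<beta> f" and "gamma_map G T \<beta> U \<gamma> g"
  shows "gamma_map G S \<alpha> U \<gamma> (\<lambda>x. g (f x))"
proof -
  have f: "f \<in> S \<rightarrow> T" using assms by (simp add: gamma_map_def ucp_map_def)
  have "completely_positive_on S (\<lambda>x. g (f x))"
    unfolding completely_positive_on_def
  proof (intro allI impI)
    fix n and X :: "nat \<Rightarrow> nat \<Rightarrow> 'h bounded_op"
    assume X: "\<forall>i<n. \<forall>j<n. X i j \<in> S" and "mat_positive n X"
    with assms(1) have "mat_positive n (\<lambda>i j. f (X i j))"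
      by (simp add: gamma_map_def ucp_map_def completely_positive_on_def)
    moreover have "\<forall>i<n. \<forall>j<n. f (X i j) \<in> T" using X f by blast
    ultimately show "mat_positive n (\<lambda>i j. g (f (X i j)))"
      using assms(2) by (simp add: gamma_map_def ucp_map_def completely_positive_on_def)
  qed
  with assms f show ?thesis
    by (auto simp: gamma_map_def ucp_map_def linear_map_on_def Pi_iff)
qed

lemma gamma_map_funpow:
  assumes "gamma_map G S \<alpha> S \<alpha> f"
  shows "gamma_map G S \<alpha> S \<alpha> (f ^^ Suc k)"
proof (induction k)
  case 0
  then show ?case using assms by simp
next
  case (Suc k)
  then show ?case using gamma_map_comp[OF Suc assms] by (simp add: o_def)
qed

lemma gamma_map_average:
  fixes f :: "nat \<Rightarrow> 'h::complex_hilbert bounded_op \<Rightarrow> 'k::complex_hilbert bounded_op"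
  assumes f: "\<And>k. gamma_map G UNIV \<alpha> UNIV \<beta> (f k)" and n: "0 < n"
  shows "gamma_map G UNIV \<alpha> UNIV \<beta> (\<lambda>x. (1 / real n) *\<^sub>R (\<Sum>k<n. f k x))"
    (is "gamma_map _ _ _ _ _ ?A")
proof -
  have lin: "linear_map_on UNIV (f k)" and one: "f k 1 = 1" for k
    using f[of k] by (auto simp: gamma_map_def ucp_map_def)
  have "linear_map_on UNIV ?A"
    unfolding linear_map_on_def
    by (auto simp: linear_map_on_UNIV_simps[OF lin] sum.distrib scaleC_add_right scaleR_scaleC
        scaleC_scaleC mult.commute linear_sum[OF bounded_linear.linear[OF bounded_linear_scaleC]])
  moreover have "?A 1 = 1"
    using n by (simp add: one sum_constant_scaleR)
  moreover have "completely_positive_on UNIV ?A"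
    unfolding completely_positive_on_def
  proof (intro allI impI)
    fix m and X :: "nat \<Rightarrow> nat \<Rightarrow> 'h bounded_op"
    assume "mat_positive m X"
    then have pos: "mat_positive m (\<lambda>i j. f k (X i j))" for k
      using f[of k] by (simp add: gamma_map_def ucp_map_def completely_positive_on_def)
    show "mat_positive m (\<lambda>i j. ?A (X i j))"
      unfolding mat_positive_iff_form
    proof
      fix u
      have "mat_form m (\<lambda>i j. ?A (X i j)) u u
          = of_real (1 / real n) * (\<Sum>i<m. \<Sum>j<m. \<Sum>k<n. cinner (u i) (f k (X i j) \<cdot>\<^sub>o u j))"
        by (simp only: mat_form_def op_apply_scaleR op_apply_sum cinner_scaleR_right
            cinner_sum_right sum_distrib_left)
      also have "(\<Sum>i<m. \<Sum>j<m. \<Sum>k<n. cinner (u i) (f k (X i j) \<cdot>\<^sub>o u j))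
          = (\<Sum>i<m. \<Sum>k<n. \<Sum>j<m. cinner (u i) (f k (X i j) \<cdot>\<^sub>o u j))"
        by (rule sum.cong[OF refl], rule sum.swap)
      also have "\<dots> = (\<Sum>k<n. mat_form m (\<lambda>i j. f k (X i j)) u u)"
        unfolding mat_form_def by (rule sum.swap)
      finally show "mat_form m (\<lambda>i j. ?A (X i j)) u u \<in> \<real>\<^sub>\<ge>\<^sub>0"
        using pos n by (auto simp: mat_positive_iff_form complex_nonneg_Reals_iff
            intro!: sum_nonneg divide_nonneg_nonneg)
    qed
  qed
  moreover have "?A (\<alpha> g x) = \<beta> g (?A x)" if "g \<in> carrier G" for g x
  proof -
    have \<beta>: "linear_map_on UNIV (\<beta> g)"
      using f[of 0] that by (simp add: gamma_map_def gamma_operator_system_def ucp_map_def)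
    then show ?thesis
      using f that by (simp add: linear_map_on_UNIV_simps(3)[OF \<beta>] linear_map_on_UNIV_sum[OF \<beta>]
          gamma_map_def)
  qed
  ultimately show ?thesis
    using f[of 0] by (simp add: gamma_map_def ucp_map_def)
qed

lemma gamma_operator_system_subgroup:
  assumes "gamma_operator_system G S \<alpha>" and "subgroup L G"
  shows "gamma_operator_system (G\<lparr>carrier := L\<rparr>) S \<alpha>"
  using assms(1) subgroup.mem_carrier[OF assms(2)] by (simp add: gamma_operator_system_def)

text \<open>Images of equivariant maps need not be closed; an operator system here is not required to be.\<close>

lemma gamma_operator_system_range:
  assumes "gamma_map G UNIV \<alpha> UNIV \<beta> f"
  shows "gamma_operator_system G (range f) \<beta>"
proof -
  have ucp: "ucp_map UNIV UNIV f" and lin: "linear_map_on UNIV f" and one: "f 1 = 1"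
    and os: "gamma_operator_system G UNIV \<alpha>" "gamma_operator_system G UNIV \<beta>"
    using assms by (auto simp: gamma_map_def ucp_map_def)
  have "operator_system (range f)"
    unfolding operator_system_def
  proof (intro conjI ballI allI)
    show "1 \<in> range f" by (metis one rangeI)
    show "x + y \<in> range f" if "x \<in> range f" "y \<in> range f" for x y
      using that by (auto simp flip: linear_map_on_UNIV_simps[OF lin])
    show "c *\<^sub>C x \<in> range f" if "x \<in> range f" for c x
      using that by (auto simp flip: linear_map_on_UNIV_simps[OF lin])
    show "\<exists>y\<in>range f. is_adjoint x y" if "x \<in> range f" for x
      using that os(1) ucp_map_adjoint[OF ucp]
      by (fastforce simp: gamma_operator_system_def operator_system_def)
  qed
  moreover have "ucp_map (range f) (range f) (\<beta> g)" if "g \<in> carrier G" for g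
  proof (rule ucp_map_subset)
    show "ucp_map UNIV UNIV (\<beta> g)"
      using os(2) that by (simp add: gamma_operator_system_def)
    have "\<beta> g (f x) = f (\<alpha> g x)" for x
      using assms that by (simp add: gamma_map_def)
    then show "\<beta> g ` range f \<subseteq> range f" by auto
  qed simp
  ultimately show ?thesis
    using os(2) by (simp add: gamma_operator_system_def)
qed

section \<open>Rigidity of minimal maps\<close>

text \<open>The norms of \<open>\<tau>\<close> and \<open>\<psi>\<close> are compared pointwise in \<open>fh_le\<close>; applied to averages of powers of
  \<open>\<tau>\<close>, minimality upgrades \<open>\<tau> \<le> \<psi>\<close> to the equality \<open>\<psi> \<circ> \<tau> = \<psi>\<close>.\<close>

lemma fh_minimal_absorb:
  fixes \<psi> \<tau> :: "'h::complex_hilbert bounded_op \<Rightarrow> 'h bounded_op"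
  assumes min: "fh_minimal G \<pi> \<psi>"
    and \<tau>: "\<tau> \<in> gamma_self_maps G \<pi>" and le: "fh_le \<tau> \<psi>"
  shows "\<psi> (\<tau> x) = \<psi> x"
proof -
  let ?\<alpha> = "conj_action G \<pi>"
  have \<psi>: "gamma_map G UNIV ?\<alpha> UNIV ?\<alpha> \<psi>" and map: "gamma_map G UNIV ?\<alpha> UNIV ?\<alpha> \<tau>"
    using min \<tau> by (auto simp: fh_minimal_def gamma_self_maps_def)
  then have os: "operator_system (UNIV :: 'h bounded_op set)"
    by (simp add: gamma_map_def gamma_operator_system_def)
  have pow: "gamma_map G UNIV ?\<alpha> UNIV ?\<alpha> (\<tau> ^^ Suc k)" for k
    by (rule gamma_map_funpow[OF map])
  have pow_norm: "norm ((\<tau> ^^ Suc k) y) \<le> norm (\<tau> y)" for k y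
  proof (cases k)
    case (Suc l)
    have "(\<tau> ^^ Suc k) y = (\<tau> ^^ Suc l) (\<tau> y)"
      unfolding Suc by (simp only: funpow_Suc_right o_apply)
    then show ?thesis
      using norm_ucp_le[OF _ os, of UNIV "\<tau> ^^ Suc l" "\<tau> y"] pow[of l] by (simp add: gamma_map_def)
  qed simp
  have pow_diff: "(\<tau> ^^ Suc k) (x - \<tau> x) = (\<tau> ^^ Suc k) x - (\<tau> ^^ Suc (Suc k)) x" for k
  proof -
    have "linear_map_on UNIV (\<tau> ^^ Suc k)" using pow by (simp add: gamma_map_def ucp_map_def)
    from linear_map_on_UNIV_simps(5)[OF this, of x "\<tau> x"] show ?thesis
      by (simp only: funpow_Suc_right[of "Suc k"] o_apply)
  qed
  have bound: "norm (\<psi> (x - \<tau> x)) \<le> 2 * norm (\<tau> x) / real n" if n: "0 < n" for n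
  proof -
    define A where "A y = (1 / real n) *\<^sub>R (\<Sum>k<n. (\<tau> ^^ Suc k) y)" for y
    have "A \<in> gamma_self_maps G \<pi>"
      unfolding gamma_self_maps_def A_def
      using gamma_map_average[OF pow n] by simp
    moreover have "fh_le A \<psi>"
      unfolding fh_le_def
    proof
      fix y
      have "norm (\<Sum>k<n. (\<tau> ^^ Suc k) y) \<le> (\<Sum>k<n. norm (\<psi> y))"
        using pow_norm[of _ y] le unfolding fh_le_def
        by (intro sum_norm_le) (meson order_trans)
      then show "norm (A y) \<le> norm (\<psi> y)"
        using n by (simp add: A_def field_simps)
    qed
    ultimately have "fh_le \<psi> A"
      using min by (simp add: fh_minimal_def)
    then have "norm (\<psi> (x - \<tau> x)) \<le> norm (A (x - \<tau> x))"
      by (simp add: fh_le_def)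
    also have "A (x - \<tau> x) = (1 / real n) *\<^sub>R (\<tau> x - (\<tau> ^^ Suc n) x)"
      unfolding A_def pow_diff using sum_lessThan_telescope'[of "\<lambda>k. (\<tau> ^^ Suc k) x" n] by simp
    also have "norm \<dots> \<le> (1 / real n) * (norm (\<tau> x) + norm ((\<tau> ^^ Suc n) x))"
      unfolding norm_scaleR by (rule mult_mono) (auto intro: norm_triangle_ineq4)
    also have "\<dots> \<le> (1 / real n) * (norm (\<tau> x) + norm (\<tau> x))"
      by (intro mult_left_mono add_left_mono pow_norm) simp
    finally show ?thesis by simp
  qed
  have "norm (\<psi> (x - \<tau> x)) \<le> 0"
  proof (rule LIMSEQ_le_const)
    show "(\<lambda>n. 2 * norm (\<tau> x) / real n) \<longlonglongrightarrow> 0"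
      by (rule lim_const_over_n)
    show "\<exists>N. \<forall>n\<ge>N. norm (\<psi> (x - \<tau> x)) \<le> 2 * norm (\<tau> x) / real n"
      using bound by (intro exI[of _ 1]) auto
  qed
  moreover have "\<psi> (x - \<tau> x) = \<psi> x - \<psi> (\<tau> x)"
    using \<psi> by (intro linear_map_on_UNIV_simps(5)) (simp add: gamma_map_def ucp_map_def)
  ultimately show ?thesis by simp
qed

lemma fh_minimal_left_inverse:
  fixes \<psi> \<phi> :: "'h::complex_hilbert bounded_op \<Rightarrow> 'h bounded_op"
  assumes min: "fh_minimal G \<pi> \<psi>" and \<phi>: "\<phi> \<in> gamma_self_maps G \<pi>"
  shows "\<psi> (\<phi> (\<psi> x)) = \<psi> x"
proof -
  let ?\<alpha> = "conj_action G \<pi>"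
  let ?\<tau> = "\<lambda>x. \<psi> (\<phi> (\<psi> x))"
  have \<psi>: "gamma_map G UNIV ?\<alpha> UNIV ?\<alpha> \<psi>" and \<phi>': "gamma_map G UNIV ?\<alpha> UNIV ?\<alpha> \<phi>"
    using min \<phi> by (auto simp: fh_minimal_def gamma_self_maps_def)
  then have os: "operator_system (UNIV :: 'h bounded_op set)"
    by (simp add: gamma_map_def gamma_operator_system_def)
  have "ucp_map UNIV UNIV (\<lambda>x. \<psi> (\<phi> x))"
    using gamma_map_comp[OF \<phi>' \<psi>] by (simp add: gamma_map_def)
  then have "fh_le ?\<tau> \<psi>"
    unfolding fh_le_def using norm_ucp_le[OF _ os] by blast
  moreover have "?\<tau> \<in> gamma_self_maps G \<pi>"
    using gamma_map_comp[OF gamma_map_comp[OF \<psi> \<phi>'] \<psi>] by (simp add: gamma_self_maps_def)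
  ultimately have "\<psi> (?\<tau> x) = \<psi> x"
    by (intro fh_minimal_absorb[OF min])
  moreover have idem: "\<psi> (\<psi> y) = \<psi> y" for y
    using min by (intro fh_minimal_absorb) (auto simp: fh_minimal_def fh_le_def)
  ultimately show ?thesis by simp
qed

section \<open>The embedding of boundaries\<close>

theorem lemma3p21:
  fixes G :: "('g, 'm) monoid_scheme"
    and L :: "'g set"
    and \<pi> :: "'g \<Rightarrow> 'h::complex_hilbert bounded_op"
    and \<phi> \<psi> :: "'h bounded_op \<Rightarrow> 'h bounded_op"
  assumes "group G"
    and "unitary_rep G \<pi>"
    and "subgroup L G"
    and "fh_minimal G \<pi> \<phi>"
    and "fh_minimal (G\<lparr>carrier := L\<rparr>) (restrict \<pi> L) \<psi>"
  shows "\<exists>f. gamma_embedding (G\<lparr>carrier := L\<rparr>)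
    (carrier (fh_boundary \<psi>)) (conj_action (G\<lparr>carrier := L\<rparr>) (restrict \<pi> L))
    (carrier (fh_boundary \<phi>)) (conj_action G \<pi>) f"
proof
  let ?H = "G\<lparr>carrier := L\<rparr>"
  let ?\<alpha> = "conj_action G \<pi>" and ?\<beta> = "conj_action ?H (restrict \<pi> L)"
  have action: "?\<beta> g = ?\<alpha> g" if "g \<in> L" for g
    using that subgroup.m_inv_closed[OF assms(3)] group.m_inv_consistent[OF assms(1,3)]
    by (simp add: conj_action_def fun_eq_iff)
  have \<phi>: "gamma_map G UNIV ?\<alpha> UNIV ?\<alpha> \<phi>" and \<psi>: "gamma_map ?H UNIV ?\<beta> UNIV ?\<beta> \<psi>"
    using assms(4,5) by (auto simp: fh_minimal_def gamma_self_maps_def)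
  then have os: "operator_system (UNIV :: 'h bounded_op set)"
    by (simp add: gamma_map_def gamma_operator_system_def)
  have ucp: "ucp_map UNIV UNIV \<phi>" "ucp_map UNIV UNIV \<psi>"
    using \<phi> \<psi> by (auto simp: gamma_map_def)
  have equiv: "\<phi> (?\<beta> g x) = ?\<alpha> g (\<phi> x)" if "g \<in> L" for g x
    using \<phi> that subgroup.mem_carrier[OF assms(3)] by (simp add: gamma_map_def action)
  have "\<phi> \<in> gamma_self_maps ?H (restrict \<pi> L)"
    using \<psi> ucp equiv by (simp add: gamma_self_maps_def gamma_map_def action)
  note left_inverse = fh_minimal_left_inverse[OF assms(5) this]
  have "gamma_map ?H (range \<psi>) ?\<beta> (range \<phi>) ?\<alpha> \<phi>"
    unfolding gamma_map_def
  proof (intro conjI)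
    show "gamma_operator_system ?H (range \<psi>) ?\<beta>"
      by (rule gamma_operator_system_range[OF \<psi>])
    show "gamma_operator_system ?H (range \<phi>) ?\<alpha>"
      by (rule gamma_operator_system_subgroup[OF gamma_operator_system_range[OF \<phi>] assms(3)])
    show "ucp_map (range \<psi>) (range \<phi>) \<phi>"
      by (rule ucp_map_subset[OF ucp(1)]) auto
    show "\<forall>g\<in>carrier ?H. \<forall>x\<in>range \<psi>. \<phi> (?\<beta> g x) = ?\<alpha> g (\<phi> x)"
      using equiv by simp
  qed
  moreover have "completely_isometric_on (range \<psi>) \<phi>"
    unfolding completely_isometric_on_def
  proof (intro allI impI antisym)
    fix n and X :: "nat \<Rightarrow> nat \<Rightarrow> 'h bounded_op"
    assume X: "\<forall>i<n. \<forall>j<n. X i j \<in> range \<psi>"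
    show "mat_norm n (\<lambda>i j. \<phi> (X i j)) \<le> mat_norm n X"
      by (rule mat_norm_ucp_le[OF ucp(1) os])
    have "mat_norm n X = mat_norm n (\<lambda>i j. \<psi> (\<phi> (X i j)))"
      using X left_inverse by (intro mat_norm_cong) fastforce
    also have "\<dots> \<le> mat_norm n (\<lambda>i j. \<phi> (X i j))"
      by (rule mat_norm_ucp_le[OF ucp(2) os])
    finally show "mat_norm n X \<le> mat_norm n (\<lambda>i j. \<phi> (X i j))" .
  qed
  ultimately show "gamma_embedding ?H (carrier (fh_boundary \<psi>)) ?\<beta> (carrier (fh_boundary \<phi>)) ?\<alpha> \<phi>"
    by (simp add: gamma_embedding_def fh_boundary_def)
qed

end
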